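(* For each $n\in N$ let $\mathcal{D}_n$ be a coherent set of desirable gambles on $\mathcal{X}_n$, and let $\boxtimes_{n\in N}\mathcal{D}_n$ be their strong product. Consider the coherent lower previsions $\underline{P}_n$ on $\mathcal{G}(\mathcal{X}_n)$ given by $\underline{P}_n(f):=\sup\{\mu\in\mathbb{R}:f-\mu\in\mathcal{D}_n\}$. Then the strong product $\underline{S}_N$ of the marginal lower previsions $\underline{P}_n$, $n\in N$, given by $$\underline{S}_N(f):=\inf\{(\times_{n\in N}P_n)(f) : (\forall n\in N)\ P_n\in\mathcal{M}(\underline{P}_n)\},$$ satisfies $$\underline{S}_N(f)=\sup\{\mu\in\mathbb{R}:f-\mu\in\boxtimes_{n\in N}\mathcal{D}_n\}\quad\text{for all }f\in\mathcal{G}(\mathcal{X}_N).$$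
   Context: Let $N$ be a finite non-empty index set, and for each $n\in N$ let $\mathcal{X}_n$ be a finite non-empty set. For $R\subseteq N$ let $\mathcal{X}_R:=\prod_{r\in R}\mathcal{X}_r$, with $\mathcal{X}_\emptyset$ a one-point set. For a finite non-empty set $\mathcal{Z}$, a gamble on $\mathcal{Z}$ is a function $\mathcal{Z}\to\mathbb{R}$; $\mathcal{G}(\mathcal{Z})$ is the linear space of all gambles on $\mathcal{Z}$; real numbers are identified with constant gambles. Write $f\geq g$ for pointwise inequality and $f>g$ if $f\geq g$ and $f\neq g$; $\mathcal{G}(\mathcal{Z})_{>0}:=\{f\in\mathcal{G}(\mathcal{Z}):f>0\}$. For $\mathcal{A}\subseteq\mathcal{G}(\mathcal{Z})$, $\mathrm{posi}(\mathcal{A}):=\{\sum_{k=1}^{m}\lambda_kf_k : m\geq 1,\ f_k\in\mathcal{A},\ \lambda_k>0\}$. A set of desirable gambles $\mathcal{D}\subseteq\mathcal{G}(\mathcal{Z})$ is coherent if (D1) $0\notin\mathcal{D}$; (D2) $\mathcal{G}(\mathcal{Z})_{>0}\subseteq\mathcal{D}$; (D3) $\mathrm{posi}(\mathcal{D})=\mathcal{D}$. A coherent set is maximal if it is not strictly included in any other coherent set of desirable gambles on $\mathcal{Z}$; $\mathbb{M}(\mathcal{Z})$ is the set of all maximal coherent sets, and $m(\mathcal{D}):=\{\mathcal{M}\in\mathbb{M}(\mathcal{Z}):\mathcal{D}\subseteq\mathcal{M}\}$. For $R\subseteq N$, a gamble on $\mathcal{X}_R$ is identified with its cylindrical extension to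 $\mathcal{X}_N$; $\mathbb{I}_{\{x_R\}}$ denotes the indicator of $x_R\in\mathcal{X}_R$. For coherent $\mathcal{D}_n\subseteq\mathcal{G}(\mathcal{X}_n)$, $n\in N$, define $$\otimes_{n\in N}\mathcal{D}_n:=\mathrm{posi}\Big(\mathcal{G}(\mathcal{X}_N)_{>0}\cup\bigcup_{n\in N}\mathrm{posi}\left(\{\mathbb{I}_{\{x_{N\setminus\{n\}}\}}g : g\in\mathcal{D}_n,\ x_{N\setminus\{n\}}\in\mathcal{X}_{N\setminus\{n\}}\}\right)\Big)$$ and the strong product $\boxtimes_{n\in N}\mathcal{D}_n:=\bigcap\{\otimes_{n\in N}\mathcal{M}_n : \mathcal{M}_n\in m(\mathcal{D}_n),\ n\in N\}$. A linear prevision $P$ on $\mathcal{G}(\mathcal{Z})$ is an expectation operator $P(f)=\sum_{z\in\mathcal{Z}}p(z)f(z)$ for a probability mass function $p$ on $\mathcal{Z}$. $\mathcal{M}(\underline{P}_n)$ is the set of linear previsions $P$ on $\mathcal{G}(\mathcal{X}_n)$ with $P(f)\geq\underline{P}_n(f)$ for all $f\in\mathcal{G}(\mathcal{X}_n)$. For linear previsions $P_n$ with mass functions $p_n$, $\times_{n\in N}P_n$ is the linear prevision on $\mathcal{G}(\mathcal{X}_N)$ with mass function $x_N\mapsto\prod_{n\in N}p_n(x_n)$. *)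

theory Defs
  imports "HOL-Probability.Probability"
begin

section \<open>Gambles and coherent sets of desirable gambles\<close>

text \<open>
  Spaces are finite sets inside a type.  A gamble on \<open>Z\<close> is represented by the unique
  real function that agrees with it on \<open>Z\<close> and vanishes off \<open>Z\<close>; thus equality, pointwise
  order and linear combinations of gambles are those of functions.  (Maps restricted to \<open>Z\<close>
  with value \<open>undefined\<close> outside would not be closed under pointwise operations.)
\<close>

definition gambles :: "'z set \<Rightarrow> ('z \<Rightarrow> real) set" where
  "gambles Z = {f. \<forall>z. z \<notin> Z \<longrightarrow> f z = 0}"

definition const_gamble :: "'z set \<Rightarrow> real \<Rightarrow> 'z \<Rightarrow> real" where
  "const_gamble Z \<mu> = (\<lambda>z. if z \<in> Z then \<mu> else 0)"

definition pos_gambles :: "'z set \<Rightarrow> ('z \<Rightarrow> real) set" where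
  "pos_gambles Z = {f \<in> gambles Z. const_gamble Z 0 \<le> f \<and> f \<noteq> const_gamble Z 0}"

definition posi :: "('z \<Rightarrow> real) set \<Rightarrow> ('z \<Rightarrow> real) set" where
  "posi A = {(\<lambda>z. \<Sum>k<m. c k * g k z) | (m :: nat) c g.
               m \<ge> 1 \<and> (\<forall>k<m. g k \<in> A \<and> c k > 0)}"

definition coherent :: "'z set \<Rightarrow> ('z \<Rightarrow> real) set \<Rightarrow> bool" where
  "coherent Z D \<longleftrightarrow>
     D \<subseteq> gambles Z \<and> const_gamble Z 0 \<notin> D \<and> pos_gambles Z \<subseteq> D \<and> posi D = D"

definition maximal_coherent :: "'z set \<Rightarrow> ('z \<Rightarrow> real) set set" where
  "maximal_coherent Z = {M. coherent Z M \<and> (\<forall>D. coherent Z D \<longrightarrow> \<not> M \<subset> D)}"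

definition maximal_supersets :: "'z set \<Rightarrow> ('z \<Rightarrow> real) set \<Rightarrow> ('z \<Rightarrow> real) set set" where
  "maximal_supersets Z D = {M \<in> maximal_coherent Z. D \<subseteq> M}"


section \<open>Products of sets of desirable gambles\<close>

text \<open>
  The space \<open>\<X>\<^sub>R\<close> is \<open>Pi\<^sub>E R X\<close>, so that \<open>\<X>\<^sub>\<emptyset>\<close> is the singleton of the everywhere undefined
  function.  A gamble \<open>g\<close> on \<open>X n\<close> is regarded as the gamble \<open>\<lambda>y. g (y n)\<close> on \<open>Pi\<^sub>E {n} X\<close>.
\<close>

definition cylindrical ::
    "'n set \<Rightarrow> ('n \<Rightarrow> 'x set) \<Rightarrow> 'n set \<Rightarrow> (('n \<Rightarrow> 'x) \<Rightarrow> real) \<Rightarrow> ('n \<Rightarrow> 'x) \<Rightarrow> real" where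
  "cylindrical N X R f = (\<lambda>x. if x \<in> Pi\<^sub>E N X then f (restrict x R) else 0)"

definition independent_nat_ext ::
    "'n set \<Rightarrow> ('n \<Rightarrow> 'x set) \<Rightarrow> ('n \<Rightarrow> ('x \<Rightarrow> real) set) \<Rightarrow> (('n \<Rightarrow> 'x) \<Rightarrow> real) set" where
  "independent_nat_ext N X D =
     posi (pos_gambles (Pi\<^sub>E N X) \<union>
       (\<Union>n\<in>N. posi {(\<lambda>x. cylindrical N X (N - {n}) (indicator {y}) x
                          * cylindrical N X {n} (\<lambda>w. g (w n)) x) | g y.
                        g \<in> D n \<and> y \<in> Pi\<^sub>E (N - {n}) X}))"

definition strong_product ::
    "'n set \<Rightarrow> ('n \<Rightarrow> 'x set) \<Rightarrow> ('n \<Rightarrow> ('x \<Rightarrow> real) set) \<Rightarrow> (('n \<Rightarrow> 'x) \<Rightarrow> real) set" where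
  "strong_product N X D =
     \<Inter>{independent_nat_ext N X M | M. \<forall>n\<in>N. M n \<in> maximal_supersets (X n) (D n)}"


section \<open>Lower and linear previsions\<close>

definition lower_prevision :: "'z set \<Rightarrow> ('z \<Rightarrow> real) set \<Rightarrow> ('z \<Rightarrow> real) \<Rightarrow> real" where
  "lower_prevision Z D f = Sup {\<mu>. f - const_gamble Z \<mu> \<in> D}"

definition linear_previsions :: "'z set \<Rightarrow> (('z \<Rightarrow> real) \<Rightarrow> real) set" where
  "linear_previsions Z = {measure_pmf.expectation p | p. set_pmf p \<subseteq> Z}"

definition mass_function :: "(('z \<Rightarrow> real) \<Rightarrow> real) \<Rightarrow> 'z pmf" where
  "mass_function P = (THE p. P = measure_pmf.expectation p)"

definition credal_set ::
    "'z set \<Rightarrow> (('z \<Rightarrow> real) \<Rightarrow> real) \<Rightarrow> (('z \<Rightarrow> real) \<Rightarrow> real) set" where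
  "credal_set Z L = {P \<in> linear_previsions Z. \<forall>f\<in>gambles Z. P f \<ge> L f}"

text \<open>
  The default value \<open>undefined\<close> makes \<open>Pi_pmf\<close> live on the extensional functions, hence on
  \<open>Pi\<^sub>E N X\<close> when the factors live on \<open>X n\<close>.
\<close>

definition product_prevision ::
    "'n set \<Rightarrow> ('n \<Rightarrow> ('x \<Rightarrow> real) \<Rightarrow> real) \<Rightarrow> (('n \<Rightarrow> 'x) \<Rightarrow> real) \<Rightarrow> real" where
  "product_prevision N P =
     measure_pmf.expectation (Pi_pmf N undefined (\<lambda>n. mass_function (P n)))"

definition strong_product_prevision ::
    "'n set \<Rightarrow> ('n \<Rightarrow> 'x set) \<Rightarrow> ('n \<Rightarrow> ('x \<Rightarrow> real) \<Rightarrow> real) \<Rightarrow> (('n \<Rightarrow> 'x) \<Rightarrow> real) \<Rightarrow> real" where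
  "strong_product_prevision N X L f =
     Inf {product_prevision N P f | P. \<forall>n\<in>N. P n \<in> credal_set (X n) (L n)}"

text \<open>On finite spaces these are the expected finite sums, and mass functions are unique.\<close>

lemma expectation_eq_sum:
  fixes f :: "'z \<Rightarrow> real"
  assumes "finite Z" "set_pmf p \<subseteq> Z"
  shows "measure_pmf.expectation p f = (\<Sum>z\<in>Z. pmf p z * f z)"
  using integral_measure_pmf_real[OF assms(1), of p f] assms(2)
  by (auto simp: mult.commute)

lemma mass_function_expectation:
  fixes p :: "'z pmf"
  shows "mass_function (measure_pmf.expectation p) = p"
  unfolding mass_function_def
proof (rule the_equality)
  fix q :: "'z pmf"
  assume eq: "(measure_pmf.expectation p :: ('z \<Rightarrow> real) \<Rightarrow> real) = measure_pmf.expectation q"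
  show "q = p"
  proof (rule pmf_eqI)
    fix z
    show "pmf q z = pmf p z"
      using fun_cong[OF eq, of "indicator {z}"] by (simp add: pmf.rep_eq)
  qed
qed simp

lemma product_prevision_eq_sum:
  assumes "finite N" "\<And>n. n \<in> N \<Longrightarrow> finite (X n)" "\<And>n. n \<in> N \<Longrightarrow> set_pmf (p n) \<subseteq> X n"
  shows "product_prevision N (\<lambda>n. measure_pmf.expectation (p n)) f =
    (\<Sum>x\<in>Pi\<^sub>E N X. (\<Prod>n\<in>N. pmf (p n) (x n)) * f x)"
proof -
  have sub: "set_pmf (Pi_pmf N undefined p) \<subseteq> Pi\<^sub>E N X"
    using assms by (auto simp: set_Pi_pmf PiE_dflt_def PiE_def extensional_def)
  have fin: "finite (Pi\<^sub>E N X)"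
    using assms by (intro finite_PiE) auto
  show ?thesis
    unfolding product_prevision_def mass_function_expectation expectation_eq_sum[OF fin sub]
    using assms(1) by (intro sum.cong refl) (auto simp: pmf_Pi PiE_def extensional_def)
qed

end

theory Submission
  imports Defs
begin

text \<open>
  A maximal coherent set contains every nonzero gamble or its negative, which makes its lower
  prevision linear: it is the expectation of a mass function \<open>p\<close>, with expectation nonnegative on
  the set and every gamble of positive expectation in the set.  Conversely, if \<open>P\<close> dominates
  the lower prevision of \<open>D\<close>, then \<open>D \<union> {f. P f > 0}\<close> is coherent, so a maximal set that includes it
  represents \<open>P\<close>.  Hence the credal set of \<open>D\<close> consists of the previsions of the maximal sets
  that include \<open>D\<close>.

  It remains to see that the independent natural extension of maximal sets has the product of
  their previsions as lower prevision.  All its generators have nonnegative product expectation.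
  For the other inequality, replace \<open>f\<close> successively by its averages over single coordinates:
  each step changes \<open>f\<close>, up to an arbitrarily small constant, by a sum of generators, and after
  the last step a constant is left.
\<close>

section \<open>Positive cones and the positive hull\<close>

text \<open>Only strictly positive factors are allowed, so a cone may omit zero, as coherent sets
  do. Closure under \<open>posi\<close> is reduced to these two rules.\<close>

definition pos_cone :: "('z \<Rightarrow> real) set \<Rightarrow> bool" where
  "pos_cone C \<longleftrightarrow> (\<forall>f\<in>C. \<forall>g\<in>C. (\<lambda>z. f z + g z) \<in> C) \<and> (\<forall>c>0. \<forall>f\<in>C. (\<lambda>z. c * f z) \<in> C)"

lemma pos_cone_add: "pos_cone C \<Longrightarrow> f \<in> C \<Longrightarrow> g \<in> C \<Longrightarrow> (\<lambda>z. f z + g z) \<in> C"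
  and pos_cone_scale: "pos_cone C \<Longrightarrow> c > 0 \<Longrightarrow> f \<in> C \<Longrightarrow> (\<lambda>z. c * f z) \<in> C"
  by (auto simp: pos_cone_def)

lemma pos_cone_sum:
  assumes "pos_cone C" "finite I" "I \<noteq> {}" "\<And>i. i \<in> I \<Longrightarrow> f i \<in> C"
  shows "(\<lambda>z. \<Sum>i\<in>I. f i z) \<in> C"
  using assms(2-4)
proof (induction I rule: finite_ne_induct)
  case (singleton i)
  then show ?case by simp
next
  case (insert i I)
  then have "(\<lambda>z. f i z + (\<Sum>i\<in>I. f i z)) \<in> C"
    by (intro pos_cone_add[OF assms(1)]) auto
  with insert show ?case by simp
qed

lemma posi_least:
  assumes "pos_cone C" "A \<subseteq> C"
  shows "posi A \<subseteq> C"
proof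
  fix f assume "f \<in> posi A"
  then obtain m :: nat and c g
    where f: "f = (\<lambda>z. \<Sum>k<m. c k * g k z)" and m: "m \<ge> 1" "\<forall>k<m. g k \<in> A \<and> c k > 0"
    unfolding posi_def by blast
  show "f \<in> C"
    unfolding f using m assms(2)
    by (intro pos_cone_sum[OF assms(1)] pos_cone_scale[OF assms(1)]) (auto simp: lessThan_empty_iff)
qed

lemma posi_superset: "A \<subseteq> posi A"
proof
  fix f assume "f \<in> A"
  then show "f \<in> posi A"
    unfolding posi_def by (intro CollectI exI[of _ "1::nat"] exI[of _ "\<lambda>_. 1"] exI[of _ "\<lambda>_. f"]) auto
qed

lemma pos_cone_posi: "pos_cone (posi A)"
  unfolding pos_cone_def
proof (intro conjI ballI allI impI)
  fix f g assume "f \<in> posi A" "g \<in> posi A"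
  then obtain m m' :: nat and c c' h h'
    where f: "f = (\<lambda>z. \<Sum>k<m. c k * h k z)" and m: "m \<ge> 1" "\<forall>k<m. h k \<in> A \<and> c k > 0"
      and g: "g = (\<lambda>z. \<Sum>k<m'. c' k * h' k z)" and m': "m' \<ge> 1" "\<forall>k<m'. h' k \<in> A \<and> c' k > 0"
    unfolding posi_def by blast
  \<comment> \<open>The two combinations are concatenated: indices from \<open>m\<close> on are
    shifted back by \<open>m\<close> into the second one.\<close>
  define d where "d = (\<lambda>k. if k < m then c k else c' (k - m))"
  define e where "e = (\<lambda>k. if k < m then h k else h' (k - m))"
  have "(\<Sum>k<m + j. d k * e k z) = (\<Sum>k<m. c k * h k z) + (\<Sum>k<j. c' k * h' k z)" for j z
    by (induction j) (simp_all add: d_def e_def)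
  moreover have "\<forall>k<m + m'. e k \<in> A \<and> d k > 0"
    using m m' by (auto simp: d_def e_def)
  ultimately show "(\<lambda>z. f z + g z) \<in> posi A"
    using m unfolding posi_def f g
    by (intro CollectI exI[of _ "m + m'"] exI[of _ d] exI[of _ e]) auto
next
  fix a :: real and f assume a: "a > 0" and "f \<in> posi A"
  then obtain m :: nat and c g
    where f: "f = (\<lambda>z. \<Sum>k<m. c k * g k z)" and m: "m \<ge> 1" "\<forall>k<m. g k \<in> A \<and> c k > 0"
    unfolding posi_def by blast
  show "(\<lambda>z. a * f z) \<in> posi A"
    using m a unfolding posi_def f
    by (intro CollectI exI[of _ m] exI[of _ "\<lambda>k. a * c k"] exI[of _ g])
      (auto simp: sum_distrib_left mult.assoc)
qed

lemma posi_eq_iff: "posi D = D \<longleftrightarrow> pos_cone D"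
  by (metis posi_superset pos_cone_posi posi_least subset_antisym subset_refl)

section \<open>Coherent sets and their maximal extensions\<close>

lemma coherent_iff:
  "coherent Z D \<longleftrightarrow> D \<subseteq> gambles Z \<and> (\<lambda>_. 0) \<notin> D \<and> pos_gambles Z \<subseteq> D \<and> pos_cone D"
  by (simp add: coherent_def posi_eq_iff const_gamble_def if_distrib cong: if_cong)

lemma pos_gambles_iff:
  "f \<in> pos_gambles Z \<longleftrightarrow> f \<in> gambles Z \<and> (\<forall>z. 0 \<le> f z) \<and> (\<exists>z. f z \<noteq> 0)"
  by (auto simp: pos_gambles_def const_gamble_def le_fun_def fun_eq_iff)

lemma coherentD:
  assumes "coherent Z D"
  shows coherent_gambles: "f \<in> D \<Longrightarrow> f \<in> gambles Z"
    and coherent_zero: "(\<lambda>_. 0) \<notin> D"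
    and coherent_pos: "f \<in> pos_gambles Z \<Longrightarrow> f \<in> D"
    and coherent_cone: "pos_cone D"
  using assms by (auto simp: coherent_iff)

text \<open>Zorn's lemma applies because any two gambles in the union of a chain already lie in one
  member of the chain. Nonemptiness of the chain places \<open>D\<close> and the positive gambles in
  the union.\<close>

lemma coherent_extends_to_maximal:
  assumes "coherent Z D"
  obtains M where "M \<in> maximal_supersets Z D"
proof -
  let ?A = "{E. coherent Z E \<and> D \<subseteq> E}"
  have "\<exists>M\<in>?A. \<forall>E\<in>?A. M \<subseteq> E \<longrightarrow> E = M"
  proof (rule subset_Zorn_nonempty)
    show "?A \<noteq> {}" using assms by auto
    fix C assume ne: "C \<noteq> {}" and "subset.chain ?A C"
    then have C: "\<And>E. E \<in> C \<Longrightarrow> coherent Z E \<and> D \<subseteq> E"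
      and ch: "\<And>E F. E \<in> C \<Longrightarrow> F \<in> C \<Longrightarrow> E \<subseteq> F \<or> F \<subseteq> E"
      by (auto simp: subset_chain_def)
    have "pos_cone (\<Union>C)"
      unfolding pos_cone_def
    proof (intro conjI ballI allI impI)
      fix f g assume "f \<in> \<Union>C" "g \<in> \<Union>C"
      then obtain E where "E \<in> C" "f \<in> E" "g \<in> E"
        using ch by blast
      then show "(\<lambda>z. f z + g z) \<in> \<Union>C"
        using C[of E] pos_cone_add[of E f g] by (auto simp: coherent_iff)
    next
      fix c :: real and f assume "c > 0" "f \<in> \<Union>C"
      then obtain E where "E \<in> C" "f \<in> E" by blast
      then show "(\<lambda>z. c * f z) \<in> \<Union>C"
        using C[of E] pos_cone_scale[of E c f] \<open>c > 0\<close> by (auto simp: coherent_iff)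
    qed
    then show "\<Union>C \<in> ?A"
      using C ne by (fastforce simp: coherent_iff)
  qed
  then obtain M where M: "coherent Z M" "D \<subseteq> M" "\<And>E. coherent Z E \<Longrightarrow> D \<subseteq> E \<Longrightarrow> M \<subseteq> E \<Longrightarrow> E = M"
    by auto
  then have "M \<in> maximal_supersets Z D"
    by (auto simp: maximal_supersets_def maximal_coherent_def)
  then show thesis ..
qed

text \<open>If \<open>f\<close> is nonzero and outside \<open>M\<close>, adjoining its negative
  creates no zero combination; the enlarged cone is coherent, so maximality makes it equal to
  \<open>M\<close>.\<close>

lemma maximal_complete:
  assumes "M \<in> maximal_coherent Z" "f \<in> gambles Z" "f \<noteq> (\<lambda>_. 0)" "f \<notin> M"
  shows "(\<lambda>z. - f z) \<in> M"
proof -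
  have M: "coherent Z M" and mx: "\<And>D. coherent Z D \<Longrightarrow> \<not> M \<subset> D"
    using assms by (auto simp: maximal_coherent_def)
  note cone = coherent_cone[OF M]
  \<comment> \<open>The cone generated by \<open>M\<close> and the negative of \<open>f\<close>. The
    disjunction excludes exactly the formal combination with \<open>g\<close> zero and
    \<open>c = 0\<close>.\<close>
  define D where "D = {(\<lambda>z. g z - c * f z) | g c. g \<in> M \<and> c = 0 \<or> g \<in> insert (\<lambda>_. 0) M \<and> c > 0}"
  have D_I: "(\<lambda>z. g z - c * f z) \<in> D" if "g \<in> M \<and> c = 0 \<or> g \<in> insert (\<lambda>_. 0) M \<and> c > 0" for g c
    unfolding D_def by (intro CollectI exI[of _ g] exI[of _ c] conjI refl that)
  have D_E: "\<exists>g c. h = (\<lambda>z. g z - c * f z) \<and> (g \<in> M \<and> c = 0 \<or> g \<in> insert (\<lambda>_. 0) M \<and> c > 0)"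
    if "h \<in> D" for h
    using that unfolding D_def mem_Collect_eq .
  have MD: "M \<subseteq> D"
  proof
    fix g assume "g \<in> M" with D_I[of g 0] show "g \<in> D" by simp
  qed
  have "coherent Z D"
    unfolding coherent_iff
  proof (intro conjI)
    show "D \<subseteq> gambles Z"
      using coherent_gambles[OF M] assms(2) unfolding D_def gambles_def by auto
    show "pos_gambles Z \<subseteq> D" using MD M by (auto simp: coherent_iff)
    show "(\<lambda>_. 0) \<notin> D"
    proof
      assume "(\<lambda>_. 0) \<in> D"
      then obtain g c where g: "(\<lambda>_. 0) = (\<lambda>z. g z - c * f z)"
        "g \<in> M \<and> c = 0 \<or> g \<in> insert (\<lambda>_. 0) M \<and> c > 0"
        by (elim D_E[elim_format] exE conjE) (rule that)
      \<comment> \<open>A zero combination forces \<open>g = c * f\<close>: with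
        \<open>c = 0\<close> this puts zero into \<open>M\<close>, with \<open>c > 0\<close> it
        makes \<open>f\<close> zero or a member of \<open>M\<close>.\<close>
      have eq: "g = (\<lambda>z. c * f z)" using fun_cong[OF g(1)] by (simp add: fun_eq_iff)
      from g(2) show False
      proof (elim disjE conjE)
        assume "g \<in> M" "c = 0" then show False using eq coherent_zero[OF M] by simp
      next
        assume c: "c > 0" and "g \<in> insert (\<lambda>_. 0) M"
        moreover have "f = (\<lambda>_. 0)" if "g = (\<lambda>_. 0)"
          using fun_cong[OF eq] that c by (simp add: fun_eq_iff)
        moreover have "g \<in> M \<Longrightarrow> f \<in> M"
          using pos_cone_scale[OF cone, of "1 / c" g] c eq by simp
        ultimately show False using assms by blast
      qed
    qed
    show "pos_cone D"
      unfolding pos_cone_def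
    proof (intro conjI ballI allI impI)
      fix h h' assume "h \<in> D" "h' \<in> D"
      then obtain g c g' c'
        where h: "h = (\<lambda>z. g z - c * f z)" "g \<in> M \<and> c = 0 \<or> g \<in> insert (\<lambda>_. 0) M \<and> c > 0"
          and h': "h' = (\<lambda>z. g' z - c' * f z)" "g' \<in> M \<and> c' = 0 \<or> g' \<in> insert (\<lambda>_. 0) M \<and> c' > 0"
        by (elim D_E[elim_format] exE conjE) (rule that)
      have "(\<lambda>z. (g z + g' z) - (c + c') * f z) \<in> D"
        using h(2) h'(2) pos_cone_add[OF cone, of g g'] by (intro D_I) auto
      then show "(\<lambda>z. h z + h' z) \<in> D" by (simp add: h h' algebra_simps)
    next
      fix a :: real and h assume a: "a > 0" and "h \<in> D"
      then obtain g c
        where h: "h = (\<lambda>z. g z - c * f z)" "g \<in> M \<and> c = 0 \<or> g \<in> insert (\<lambda>_. 0) M \<and> c > 0"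
        by (elim D_E[elim_format] exE conjE) (rule that)
      have "(\<lambda>z. a * g z - (a * c) * f z) \<in> D"
        using h(2) a pos_cone_scale[OF cone, of a g] by (intro D_I) auto
      then show "(\<lambda>z. a * h z) \<in> D" by (simp add: h algebra_simps)
    qed
  qed
  then have "D = M" using mx MD by blast
  moreover have "(\<lambda>z. 0 - 1 * f z) \<in> D" by (intro D_I) auto
  ultimately show ?thesis by simp
qed

section \<open>Lower previsions of coherent sets\<close>

lemma const_gamble_pos: "Z \<noteq> {} \<Longrightarrow> c > 0 \<Longrightarrow> const_gamble Z c \<in> pos_gambles Z"
  by (auto simp: pos_gambles_iff gambles_def const_gamble_def)

lemma minus_const_gambles: "f \<in> gambles Z \<Longrightarrow> f - const_gamble Z \<mu> \<in> gambles Z"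
  by (auto simp: gambles_def const_gamble_def)

lemma pos_minus_const:
  assumes "finite Z" "Z \<noteq> {}" "f \<in> gambles Z"
  obtains \<mu> where "f - const_gamble Z \<mu> \<in> pos_gambles Z"
proof
  \<comment> \<open>The offset 1 keeps the difference strictly positive on \<open>Z\<close>, hence
    nonzero even when \<open>f\<close> is constant.\<close>
  define \<mu> where "\<mu> = Min (f ` Z) - 1"
  have "Min (f ` Z) \<le> f z" if "z \<in> Z" for z
    using assms that by (intro Min_le) auto
  then have "f z > \<mu>" if "z \<in> Z" for z
    using that by (fastforce simp: \<mu>_def)
  then have "f z - const_gamble Z \<mu> z \<ge> 0" "z \<in> Z \<Longrightarrow> f z - const_gamble Z \<mu> z \<noteq> 0" for z
    using assms by (cases "z \<in> Z"; force simp: const_gamble_def gambles_def)+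
  then show "f - const_gamble Z \<mu> \<in> pos_gambles Z"
    using assms minus_const_gambles[OF assms(3)] by (auto simp: pos_gambles_iff)
qed

text \<open>The difference of \<open>g\<close> and \<open>f\<close> is zero or a positive gamble,
  and positive gambles can be added inside \<open>D\<close>.\<close>

lemma coherent_mono:
  assumes "coherent Z D" "f \<in> D" "g \<in> gambles Z" "\<And>z. z \<in> Z \<Longrightarrow> f z \<le> g z"
  shows "g \<in> D"
proof (cases "f = g")
  case False
  have "f \<in> gambles Z" using assms coherent_gambles by blast
  then have "0 \<le> g z - f z" for z
    using assms(3,4) by (cases "z \<in> Z") (auto simp: gambles_def)
  moreover obtain z where "g z - f z \<noteq> 0" using False by fastforce
  moreover have "(\<lambda>z. g z - f z) \<in> gambles Z"
    using assms(3) \<open>f \<in> gambles Z\<close> by (simp add: gambles_def)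
  ultimately have "(\<lambda>z. g z - f z) \<in> pos_gambles Z"
    unfolding pos_gambles_iff by blast
  then have "(\<lambda>z. f z + (g z - f z)) \<in> D"
    by (rule pos_cone_add[OF coherent_cone[OF assms(1)] assms(2) coherent_pos[OF assms(1)]])
  then show ?thesis by simp
qed (use assms in simp)

text \<open>A price above the maximum of \<open>f\<close> leaves a nonpositive remainder, and
  \<open>coherent_mono\<close> would put zero into \<open>D\<close>.\<close>

lemma coherent_acceptable_bdd:
  assumes "coherent Z D" "finite Z" "Z \<noteq> {}" "f \<in> gambles Z"
  shows "bdd_above {\<mu>. f - const_gamble Z \<mu> \<in> D}"
proof (rule bdd_aboveI)
  fix \<mu> assume "\<mu> \<in> {\<mu>. f - const_gamble Z \<mu> \<in> D}"
  then have in_D: "f - const_gamble Z \<mu> \<in> D" by simp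
  show "\<mu> \<le> Max (f ` Z)"
  proof (rule ccontr)
    assume "\<not> \<mu> \<le> Max (f ` Z)"
    moreover have "f z \<le> Max (f ` Z)" if "z \<in> Z" for z
      using assms that by (intro Max_ge) auto
    ultimately have "f z \<le> \<mu>" if "z \<in> Z" for z
      using that by fastforce
    then have "(\<lambda>_. 0) \<in> D"
      using coherent_mono[OF assms(1) in_D, of "\<lambda>_. 0"] by (auto simp: gambles_def const_gamble_def)
    then show False using coherent_zero assms by blast
  qed
qed

lemma coherent_le_lower_prevision:
  assumes "coherent Z D" "finite Z" "Z \<noteq> {}" "f - const_gamble Z \<mu> \<in> D" "f \<in> gambles Z"
  shows "\<mu> \<le> lower_prevision Z D f"
  unfolding lower_prevision_def
  using assms by (intro cSup_upper coherent_acceptable_bdd) auto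

text \<open>Acceptable prices are closed downwards, but their supremum need not be acceptable; hence
  the strict inequality.\<close>

lemma coherent_less_lower_prevision:
  assumes "coherent Z D" "finite Z" "Z \<noteq> {}" "\<mu> < lower_prevision Z D f" "f \<in> gambles Z"
  shows "f - const_gamble Z \<mu> \<in> D"
proof -
  obtain \<nu>0 where "f - const_gamble Z \<nu>0 \<in> pos_gambles Z"
    using pos_minus_const assms by blast
  then have "{\<mu>. f - const_gamble Z \<mu> \<in> D} \<noteq> {}"
    using coherent_pos[OF assms(1)] by blast
  then obtain \<nu> where \<nu>: "\<nu> > \<mu>" "f - const_gamble Z \<nu> \<in> D"
    using assms(4) less_cSup_iff[OF _ coherent_acceptable_bdd[OF assms(1-3,5)], of \<mu>]
    unfolding lower_prevision_def by blast
  show ?thesis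
    using \<nu>(1)
    by (intro coherent_mono[OF assms(1) \<nu>(2) minus_const_gambles[OF assms(5)]])
      (simp add: const_gamble_def)
qed

section \<open>Linearity of the lower prevision of a maximal set\<close>

text \<open>Superadditivity and positive homogeneity come from coherence alone.
  \<open>maximal_complete\<close> adds \<open>P (\<lambda>z. - f z) = - P f\<close>, which turns
  superadditivity into additivity and extends homogeneity to negative factors.\<close>

lemma maximal_lower_prevision_linear:
  assumes "M \<in> maximal_coherent Z" "finite Z" "Z \<noteq> {}"
  defines "P \<equiv> lower_prevision Z M"
  shows maximal_prevision_add: "f \<in> gambles Z \<Longrightarrow> g \<in> gambles Z \<Longrightarrow> P (\<lambda>z. f z + g z) = P f + P g"
    and maximal_prevision_scale: "f \<in> gambles Z \<Longrightarrow> P (\<lambda>z. c * f z) = c * P f"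
    and maximal_prevision_const: "P (const_gamble Z \<mu>) = \<mu>"
proof -
  have M: "coherent Z M" using assms by (simp add: maximal_coherent_def)
  note le = coherent_le_lower_prevision[OF M assms(2,3), folded P_def]
  note less = coherent_less_lower_prevision[OF M assms(2,3), folded P_def]
  have const: "P (const_gamble Z \<mu>) = \<mu>" for \<mu>
  proof (rule antisym; rule dense_le)
    have g: "const_gamble Z \<mu> \<in> gambles Z" by (auto simp: gambles_def const_gamble_def)
    fix x
    {
      assume "x < \<mu>"
      then have "const_gamble Z (\<mu> - x) \<in> M"
        using M assms by (intro coherent_pos[OF M] const_gamble_pos) auto
      moreover have "const_gamble Z \<mu> - const_gamble Z x = const_gamble Z (\<mu> - x)"
        by (auto simp: const_gamble_def)
      ultimately show "x \<le> P (const_gamble Z \<mu>)" using le g by simp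
    next
      assume "x < P (const_gamble Z \<mu>)"
      then have "const_gamble Z \<mu> - const_gamble Z x \<in> M" using less g by simp
      then show "x \<le> \<mu>"
        using coherent_mono[OF M, of _ "\<lambda>_. 0"] coherent_zero[OF M]
        by (force simp: const_gamble_def gambles_def)
    }
  qed
  then show "P (const_gamble Z \<mu>) = \<mu>" .
  have super: "P f + P g \<le> P (\<lambda>z. f z + g z)" if fg: "f \<in> gambles Z" "g \<in> gambles Z" for f g
  proof (rule field_le_epsilon)
    fix e :: real assume "e > 0"
    then have "f - const_gamble Z (P f - e/2) \<in> M" "g - const_gamble Z (P g - e/2) \<in> M"
      using less fg by simp_all
    from pos_cone_add[OF coherent_cone[OF M] this]
    have "(\<lambda>z. f z + g z) - const_gamble Z (P f + P g - e) \<in> M"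
      by (rule back_subst[of "\<lambda>h. h \<in> M"]) (auto simp: const_gamble_def fun_eq_iff)
    then show "P f + P g \<le> P (\<lambda>z. f z + g z) + e"
      using le[of "\<lambda>z. f z + g z" "P f + P g - e"] fg by (simp add: gambles_def)
  qed
  have zero: "P (\<lambda>_. 0) = 0" using const[of 0] by (simp add: const_gamble_def if_distrib cong: if_cong)
  have neg: "P (\<lambda>z. - f z) = - P f" if f: "f \<in> gambles Z" for f
  proof (rule antisym)
    have nf: "(\<lambda>z. - f z) \<in> gambles Z" using f by (simp add: gambles_def)
    show "P (\<lambda>z. - f z) \<le> - P f" using super[OF f nf] zero by simp
    \<comment> \<open>For \<open>x\<close> above \<open>P f\<close> the gamble \<open>f - x\<close>
      lies outside \<open>M\<close>, and it is nonzero because the constant \<open>x\<close> has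
      prevision \<open>x\<close>. Its negative is then in \<open>M\<close> and makes
      \<open>- x\<close> an acceptable price for \<open>- f\<close>.\<close>
    have "P f \<ge> - P (\<lambda>z. - f z)"
    proof (rule dense_ge)
      fix x assume x: "P f < x"
      let ?h = "f - const_gamble Z x"
      have "f \<noteq> const_gamble Z x" using const[of x] x by auto
      then have "?h \<noteq> (\<lambda>_. 0)" by (auto simp: fun_eq_iff)
      moreover have "?h \<notin> M" using le[of f x] f x by auto
      ultimately have "(\<lambda>z. - ?h z) \<in> M"
        using maximal_complete[OF assms(1)] minus_const_gambles f by blast
      then have "(\<lambda>z. - f z) - const_gamble Z (- x) \<in> M"
        by (rule back_subst[of "\<lambda>h. h \<in> M"]) (auto simp: const_gamble_def fun_eq_iff)
      then show "- P (\<lambda>z. - f z) \<le> x" using le nf by fastforce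
    qed
    then show "- P f \<le> P (\<lambda>z. - f z)" by simp
  qed
  show "P (\<lambda>z. f z + g z) = P f + P g" if fg: "f \<in> gambles Z" "g \<in> gambles Z"
  proof -
    have "(\<lambda>z. - f z) \<in> gambles Z" "(\<lambda>z. - g z) \<in> gambles Z" "(\<lambda>z. f z + g z) \<in> gambles Z"
      using fg by (simp_all add: gambles_def)
    \<comment> \<open>Superadditivity for \<open>f\<close> and \<open>g\<close> gives one
      inequality, for their negatives the other.\<close>
    then show ?thesis
      using super[OF fg] super[of "\<lambda>z. - f z" "\<lambda>z. - g z"] neg[of "\<lambda>z. f z + g z"] neg fg by simp
  qed
  have scale_le: "c * P f \<le> P (\<lambda>z. c * f z)" if f: "f \<in> gambles Z" and c: "c > 0" for f c
  proof -
    have bound: "c * x \<le> P (\<lambda>z. c * f z)" if "x < P f" for x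
    proof -
      have "f - const_gamble Z x \<in> M" using less f that by simp
      from pos_cone_scale[OF coherent_cone[OF M] c this]
      have "(\<lambda>z. c * f z) - const_gamble Z (c * x) \<in> M"
        by (rule back_subst[of "\<lambda>h. h \<in> M"]) (auto simp: const_gamble_def fun_eq_iff algebra_simps)
      then show ?thesis using le f by (simp add: gambles_def)
    qed
    have "x \<le> P (\<lambda>z. c * f z) / c" if "x < P f" for x
      using bound[OF that] c by (simp add: pos_le_divide_eq mult.commute)
    then have "P f \<le> P (\<lambda>z. c * f z) / c" by (rule dense_le)
    then show ?thesis using c by (simp add: field_simps)
  qed
  have scale: "P (\<lambda>z. c * f z) = c * P f" if f: "f \<in> gambles Z" and c: "c > 0" for f c
  proof -
    \<comment> \<open>The same bound for the gamble \<open>c * f\<close> and the factor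
      \<open>1 / c\<close> is the reverse inequality.\<close>
    have "(1 / c) * P (\<lambda>z. c * f z) \<le> P f"
      using scale_le[of "\<lambda>z. c * f z" "1 / c"] f c by (simp add: gambles_def)
    then show ?thesis using scale_le[OF f c] c by (simp add: field_simps)
  qed
  show "P (\<lambda>z. c * f z) = c * P f" if f: "f \<in> gambles Z"
  proof -
    consider "c > 0" | "c = 0" | "c < 0" by linarith
    then show ?thesis
    proof cases
      case 3
      have "P (\<lambda>z. - (- c * f z)) = - P (\<lambda>z. - c * f z)"
        using f by (intro neg) (simp add: gambles_def)
      with scale[OF f, of "- c"] 3 show ?thesis by simp
    qed (use scale f zero in simp_all)
  qed
qed

section \<open>Mass functions representing maximal sets\<close>

text \<open>\<open>M\<close> lies between the open and the closed half-space given by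
  \<open>p\<close>. Gambles of expectation zero are left open, since maximal sets with the same
  \<open>p\<close> may differ there.\<close>

definition represents :: "'z set \<Rightarrow> ('z \<Rightarrow> real) set \<Rightarrow> 'z pmf \<Rightarrow> bool" where
  "represents Z M p \<longleftrightarrow> set_pmf p \<subseteq> Z \<and>
     (\<forall>f\<in>M. (\<Sum>z\<in>Z. pmf p z * f z) \<ge> 0) \<and>
     (\<forall>f\<in>gambles Z. (\<Sum>z\<in>Z. pmf p z * f z) > 0 \<longrightarrow> f \<in> M)"

text \<open>The lower prevision of a maximal set is linear, so its values on indicators of points
  serve as masses; coherence makes them nonnegative, and the constant gamble 1 makes them sum to
  1.\<close>

lemma maximal_represented:
  assumes "M \<in> maximal_coherent Z" "finite Z" "Z \<noteq> {}"
  obtains p where "represents Z M p"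
proof -
  have M: "coherent Z M" using assms by (simp add: maximal_coherent_def)
  define P where "P = lower_prevision Z M"
  define q where "q z = (if z \<in> Z then P (indicator {z}) else 0)" for z
  note add = maximal_prevision_add[OF assms, folded P_def]
  note scale = maximal_prevision_scale[OF assms, folded P_def]
  note const = maximal_prevision_const[OF assms, folded P_def]
  have P_sum: "P f = (\<Sum>z\<in>Z. q z * f z)" if f: "f \<in> gambles Z" for f
  proof -
    \<comment> \<open>Additivity is known for two summands, so the expansion of \<open>f\<close>
      into indicators goes by induction over subsets of \<open>Z\<close>.\<close>
    have "P (\<lambda>x. \<Sum>z\<in>S. f z * indicator {z} x) = (\<Sum>z\<in>S. q z * f z)" if "S \<subseteq> Z" for S
      using finite_subset[OF that assms(2)] that
    proof (induction S rule: finite_induct)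
      case empty
      then show ?case using scale[of "\<lambda>_. 0" 0] by (simp add: gambles_def)
    next
      case (insert z S)
      have "P (\<lambda>x. f z * indicator {z} x + (\<Sum>z\<in>S. f z * indicator {z} x))
        = P (\<lambda>x. f z * indicator {z} x) + P (\<lambda>x. \<Sum>z\<in>S. f z * indicator {z} x)"
        using insert.prems by (intro add) (auto simp: gambles_def indicator_def intro!: sum.neutral)
      also have "P (\<lambda>x. f z * indicator {z} x) = q z * f z"
        using insert.prems scale[of "indicator {z}" "f z"]
        by (auto simp: gambles_def q_def indicator_def mult.commute)
      also have "P (\<lambda>x. \<Sum>z\<in>S. f z * indicator {z} x) = (\<Sum>z\<in>S. q z * f z)"
        using insert by simp
      finally show ?case by (simp only: sum.insert[OF insert.hyps(1,2)])
    qed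
    moreover have "(\<Sum>z\<in>Z. f z * indicator {z} x) = f x" for x
    proof -
      have "(\<Sum>z\<in>Z. f z * indicator {z} x) = (\<Sum>z\<in>Z. if x = z then f z else 0)"
        by (intro sum.cong) (auto simp: indicator_def)
      also have "\<dots> = f x" using f assms(2) by (simp add: sum.delta' gambles_def)
      finally show ?thesis .
    qed
    ultimately show ?thesis by (metis (no_types, lifting) ext subset_refl)
  qed
  have q_nonneg: "q z \<ge> 0" for z
  proof (cases "z \<in> Z")
    case True
    then have g: "indicator {z} \<in> pos_gambles Z"
      by (auto simp: pos_gambles_iff gambles_def indicator_def)
    moreover have "indicator {z} - const_gamble Z 0 = (indicator {z} :: _ \<Rightarrow> real)"
      by (auto simp: const_gamble_def)
    ultimately have "0 \<le> P (indicator {z})"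
      unfolding P_def using coherent_pos[OF M]
      by (intro coherent_le_lower_prevision[OF M assms(2,3)]) (auto simp: pos_gambles_iff)
    then show ?thesis using True by (simp add: q_def)
  qed (simp add: q_def)
  have "const_gamble Z 1 \<in> gambles Z" by (simp add: gambles_def const_gamble_def)
  from P_sum[OF this] have "P (const_gamble Z 1) = (\<Sum>z\<in>Z. q z)"
    by (simp add: const_gamble_def)
  then have "(\<Sum>z\<in>Z. q z) = 1" by (simp only: const)
  \<comment> \<open>\<open>embed_pmf\<close> asks for the total mass as a nonnegative integral over
    the whole type, which reduces to \<open>Z\<close> because \<open>q\<close> vanishes
    elsewhere.\<close>
  then have "(\<Sum>z\<in>Z. ennreal (q z)) = 1" using q_nonneg by (simp add: sum_ennreal)
  then have "(\<integral>\<^sup>+ z. ennreal (q z) \<partial>count_space UNIV) = 1"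
    using assms(2) by (subst nn_integral_count_space'[of Z]) (auto simp: q_def)
  then have pq: "pmf (embed_pmf q) z = q z" for z
    using q_nonneg by (intro pmf_embed_pmf) auto
  have "represents Z M (embed_pmf q)"
    unfolding represents_def pq
  proof (intro conjI ballI impI)
    show "set_pmf (embed_pmf q) \<subseteq> Z" using pq by (auto simp: set_pmf_eq q_def)
  next
    fix f assume "f \<in> M"
    moreover have "f - const_gamble Z 0 = f" by (auto simp: const_gamble_def)
    ultimately show "0 \<le> (\<Sum>z\<in>Z. q z * f z)"
      using coherent_le_lower_prevision[OF M assms(2,3), of f 0] coherent_gambles[OF M] P_sum
      by (simp add: P_def)
  next
    fix f assume "f \<in> gambles Z" "0 < (\<Sum>z\<in>Z. q z * f z)"
    moreover have "f - const_gamble Z 0 = f" by (auto simp: const_gamble_def)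
    ultimately show "f \<in> M"
      using coherent_less_lower_prevision[OF M assms(2,3), of 0 f] P_sum
      by (simp add: P_def)
  qed
  then show thesis ..
qed

lemma sum_pmf_minus_const:
  assumes "finite Z" "set_pmf p \<subseteq> Z"
  shows "(\<Sum>z\<in>Z. pmf p z * (f - const_gamble Z \<mu>) z) = (\<Sum>z\<in>Z. pmf p z * f z) - \<mu>"
  using sum_pmf_eq_1[OF assms]
  by (simp add: right_diff_distrib sum_subtractf const_gamble_def sum_distrib_right[symmetric])

text \<open>For an acceptable price \<open>\<mu>\<close> the gamble \<open>f - \<mu>\<close> lies in
  \<open>D\<close>, hence in \<open>M\<close>, so it has nonnegative expectation; this bounds
  \<open>\<mu>\<close> by the expectation of \<open>f\<close>.\<close>

lemma represents_imp_credal: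
  assumes "coherent Z D" "finite Z" "Z \<noteq> {}" "D \<subseteq> M" "represents Z M p"
  shows "measure_pmf.expectation p \<in> credal_set Z (lower_prevision Z D)"
proof -
  have sp: "set_pmf p \<subseteq> Z" using assms by (simp add: represents_def)
  have "lower_prevision Z D f \<le> measure_pmf.expectation p f" if f: "f \<in> gambles Z" for f
    unfolding lower_prevision_def expectation_eq_sum[OF assms(2) sp]
  proof (rule cSup_least)
    obtain \<mu> where "f - const_gamble Z \<mu> \<in> pos_gambles Z"
      using pos_minus_const assms f by blast
    then show "{\<mu>. f - const_gamble Z \<mu> \<in> D} \<noteq> {}"
      using coherent_pos[OF assms(1)] by blast
  next
    fix \<mu> assume "\<mu> \<in> {\<mu>. f - const_gamble Z \<mu> \<in> D}"
    then have "(\<Sum>z\<in>Z. pmf p z * (f - const_gamble Z \<mu>) z) \<ge> 0"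
      using assms(4,5) unfolding represents_def by blast
    then show "\<mu> \<le> (\<Sum>z\<in>Z. pmf p z * f z)"
      using sum_pmf_minus_const[OF assms(2) sp, of f \<mu>] by simp
  qed
  then show ?thesis using sp by (auto simp: credal_set_def linear_previsions_def)
qed

text \<open>An arbitrary maximal set that includes \<open>D\<close> need not represent
  \<open>P\<close>; the gambles of positive expectation are therefore adjoined to \<open>D\<close>
  before passing to a maximal set.\<close>

lemma credal_imp_represents:
  assumes "coherent Z D" "finite Z" "Z \<noteq> {}" "P \<in> credal_set Z (lower_prevision Z D)"
  obtains p M where "P = measure_pmf.expectation p" "M \<in> maximal_supersets Z D" "represents Z M p"
proof -
  obtain p where P: "P = measure_pmf.expectation p" and sp: "set_pmf p \<subseteq> Z"
    and dom: "\<And>f. f \<in> gambles Z \<Longrightarrow> lower_prevision Z D f \<le> P f"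
    using assms(4) by (auto simp: credal_set_def linear_previsions_def)
  define E where "E f = (\<Sum>z\<in>Z. pmf p z * f z)" for f
  have PE: "P f = E f" for f unfolding P E_def by (rule expectation_eq_sum[OF assms(2) sp])
  have E_add: "E (\<lambda>z. f z + g z) = E f + E g" for f g
    by (simp add: E_def distrib_left sum.distrib)
  have E_scale: "E (\<lambda>z. c * f z) = c * E f" for f c
    by (simp add: E_def sum_distrib_left mult.left_commute)
  have D_nonneg: "E f \<ge> 0" if "f \<in> D" for f
  proof -
    have "f - const_gamble Z 0 = f" by (auto simp: const_gamble_def)
    then have "0 \<le> lower_prevision Z D f"
      using coherent_le_lower_prevision[OF assms(1-3), of f 0] coherent_gambles[OF assms(1)] that by simp
    also have "\<dots> \<le> E f" using dom[of f] PE coherent_gambles[OF assms(1)] that by simp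
    finally show ?thesis .
  qed
  define C where "C = D \<union> {f \<in> gambles Z. E f > 0}"
  have C_nonneg: "E f \<ge> 0" if "f \<in> C" for f using that D_nonneg by (auto simp: C_def)
  have C_gambles: "C \<subseteq> gambles Z" using coherent_gambles[OF assms(1)] by (auto simp: C_def)
  have "coherent Z C"
    unfolding coherent_iff
  proof (intro conjI)
    show "C \<subseteq> gambles Z" by fact
    show "(\<lambda>_. 0) \<notin> C" using coherent_zero[OF assms(1)] by (auto simp: C_def E_def)
    show "pos_gambles Z \<subseteq> C" using coherent_pos[OF assms(1)] by (auto simp: C_def)
    show "pos_cone C"
      unfolding pos_cone_def
    proof (intro conjI ballI allI impI)
      fix f g assume fg: "f \<in> C" "g \<in> C"
      have "f \<in> gambles Z" "g \<in> gambles Z" using fg C_gambles by auto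
      then have "(\<lambda>z. f z + g z) \<in> gambles Z" by (simp add: gambles_def)
      \<comment> \<open>A summand outside \<open>D\<close> has positive expectation, and the other
        one has expectation at least zero.\<close>
      moreover have "f \<in> D \<and> g \<in> D \<or> E f + E g > 0"
        using fg C_nonneg[of f] C_nonneg[of g] by (auto simp: C_def)
      ultimately show "(\<lambda>z. f z + g z) \<in> C"
        using pos_cone_add[OF coherent_cone[OF assms(1)]] E_add by (auto simp: C_def)
    next
      fix c :: real and f assume "c > 0" "f \<in> C"
      then show "(\<lambda>z. c * f z) \<in> C"
        using pos_cone_scale[OF coherent_cone[OF assms(1)], of c f] E_scale
        by (auto simp: C_def gambles_def)
    qed
  qed
  then obtain M where "M \<in> maximal_supersets Z C" by (rule coherent_extends_to_maximal)
  then have M: "M \<in> maximal_coherent Z" "C \<subseteq> M" "coherent Z M"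
    by (auto simp: maximal_supersets_def maximal_coherent_def)
  have "E f \<ge> 0" if f: "f \<in> M" for f
  proof (rule ccontr)
    assume "\<not> E f \<ge> 0"
    \<comment> \<open>The negative of \<open>f\<close> has positive expectation, so it lies in
      \<open>C\<close> and in \<open>M\<close>; adding it to \<open>f\<close> puts zero into
      \<open>M\<close>.\<close>
    then have "(\<lambda>z. - 1 * f z) \<in> C"
      using coherent_gambles[OF M(3) f] E_scale[of "- 1" f] by (simp add: C_def gambles_def)
    then have "(\<lambda>z. f z + - 1 * f z) \<in> M"
      using M(2) by (intro pos_cone_add[OF coherent_cone[OF M(3)] f]) blast
    then show False using coherent_zero[OF M(3)] by simp
  qed
  then have "represents Z M p"
    using sp M(2) by (auto simp: represents_def C_def E_def)
  moreover have "M \<in> maximal_supersets Z D"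
    using M by (auto simp: maximal_supersets_def C_def)
  ultimately show thesis using that P by blast
qed

section \<open>Independent natural extension of represented sets\<close>

locale represented_factors =
  fixes N :: "'n set" and X :: "'n \<Rightarrow> 'x set" and M :: "'n \<Rightarrow> ('x \<Rightarrow> real) set" and p :: "'n \<Rightarrow> 'x pmf"
  assumes finite_N: "finite N"
    and X: "\<And>n. n \<in> N \<Longrightarrow> finite (X n)" "\<And>n. n \<in> N \<Longrightarrow> X n \<noteq> {}"
    and rep: "\<And>n. n \<in> N \<Longrightarrow> represents (X n) (M n) (p n)"
begin

text \<open>The product prevision as a finite sum; \<open>product_prevision_eq_E\<close> makes the
  link.\<close>

definition E :: "(('n \<Rightarrow> 'x) \<Rightarrow> real) \<Rightarrow> real" where
  "E f = (\<Sum>x\<in>Pi\<^sub>E N X. (\<Prod>n\<in>N. pmf (p n) (x n)) * f x)"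

lemma supp: "n \<in> N \<Longrightarrow> set_pmf (p n) \<subseteq> X n"
  using rep by (auto simp: represents_def)

lemma finite_PiE_NX: "R \<subseteq> N \<Longrightarrow> finite (Pi\<^sub>E R X)"
  using finite_N X by (intro finite_PiE) (auto intro: finite_subset)

lemma PiE_NX_ne: "R \<subseteq> N \<Longrightarrow> Pi\<^sub>E R X \<noteq> {}"
  using X by (auto simp: PiE_eq_empty_iff)

lemma E_const: "E (const_gamble (Pi\<^sub>E N X) c) = c"
proof -
  have "E (const_gamble (Pi\<^sub>E N X) c) = (\<Sum>x\<in>Pi\<^sub>E N X. \<Prod>n\<in>N. pmf (p n) (x n)) * c"
    by (simp add: E_def const_gamble_def sum_distrib_right)
  also have "(\<Sum>x\<in>Pi\<^sub>E N X. \<Prod>n\<in>N. pmf (p n) (x n)) = (\<Prod>n\<in>N. \<Sum>a\<in>X n. pmf (p n) a)"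
    using finite_N X by (simp add: prod_sum_PiE)
  also have "\<dots> = 1"
    using X supp by (intro prod.neutral) (auto intro!: sum_pmf_eq_1)
  finally show ?thesis by simp
qed

text \<open>A generator of the independent natural extension; \<open>slice_eq\<close> merges its two
  cylindrical factors into one conditional.\<close>

definition slice :: "'n \<Rightarrow> ('n \<Rightarrow> 'x) \<Rightarrow> ('x \<Rightarrow> real) \<Rightarrow> ('n \<Rightarrow> 'x) \<Rightarrow> real" where
  "slice n y g = (\<lambda>x. if x \<in> Pi\<^sub>E N X \<and> restrict x (N - {n}) = y then g (x n) else 0)"

lemma slice_eq:
  "(\<lambda>x. cylindrical N X (N - {n}) (indicator {y}) x * cylindrical N X {n} (\<lambda>w. g (w n)) x) = slice n y g"
  by (auto simp: slice_def cylindrical_def fun_eq_iff)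

definition nat_ext where "nat_ext = independent_nat_ext N X M"

lemma nat_ext_eq:
  "nat_ext = posi (pos_gambles (Pi\<^sub>E N X) \<union>
     (\<Union>n\<in>N. posi {slice n y g | g y. g \<in> M n \<and> y \<in> Pi\<^sub>E (N - {n}) X}))"
  unfolding nat_ext_def independent_nat_ext_def slice_eq ..

lemma nat_ext_cone: "pos_cone nat_ext"
  unfolding nat_ext_eq by (rule pos_cone_posi)

lemma pos_nat_ext: "f \<in> pos_gambles (Pi\<^sub>E N X) \<Longrightarrow> f \<in> nat_ext"
  unfolding nat_ext_eq using posi_superset by blast

lemma slice_nat_ext:
  assumes "n \<in> N" "g \<in> M n" "y \<in> Pi\<^sub>E (N - {n}) X"
  shows "slice n y g \<in> nat_ext"
proof -
  have "slice n y g \<in> posi {slice n y g | g y. g \<in> M n \<and> y \<in> Pi\<^sub>E (N - {n}) X}"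
    using assms by (intro subsetD[OF posi_superset]) auto
  then have "slice n y g \<in> (\<Union>n\<in>N. posi {slice n y g | g y. g \<in> M n \<and> y \<in> Pi\<^sub>E (N - {n}) X})"
    by (rule UN_I[OF assms(1)])
  then show ?thesis
    unfolding nat_ext_eq by (intro subsetD[OF posi_superset] UnI2)
qed

text \<open>The points that agree with \<open>y\<close> off \<open>n\<close> form a copy of
  \<open>X n\<close>, along which the masses of all other coordinates are constant and factor
  out.\<close>

lemma E_slice:
  assumes n: "n \<in> N" and y: "y \<in> Pi\<^sub>E (N - {n}) X"
  shows "E (slice n y g) = (\<Prod>k\<in>N - {n}. pmf (p k) (y k)) * (\<Sum>a\<in>X n. pmf (p n) a * g a)"
proof -
  have inj: "inj_on (\<lambda>a. y(n := a)) (X n)"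
    by (rule inj_onI) (metis fun_upd_same)
  have img: "{x \<in> Pi\<^sub>E N X. restrict x (N - {n}) = y} = (\<lambda>a. y(n := a)) ` X n"
  proof (intro set_eqI iffI)
    fix x assume "x \<in> {x \<in> Pi\<^sub>E N X. restrict x (N - {n}) = y}"
    then have x: "x \<in> Pi\<^sub>E N X" "y = restrict x (N - {n})" by auto
    then have "x = y(n := x n)"
      by (auto simp: fun_eq_iff PiE_def extensional_def restrict_def)
    moreover have "x n \<in> X n" using x(1) n by auto
    ultimately show "x \<in> (\<lambda>a. y(n := a)) ` X n" by (rule image_eqI)
  next
    fix x assume "x \<in> (\<lambda>a. y(n := a)) ` X n"
    then obtain a where "a \<in> X n" "x = y(n := a)" by auto
    then show "x \<in> {x \<in> Pi\<^sub>E N X. restrict x (N - {n}) = y}"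
      using y n by (auto simp: fun_eq_iff PiE_def extensional_def restrict_def Pi_def)
  qed
  have "E (slice n y g) = (\<Sum>x\<in>{x \<in> Pi\<^sub>E N X. restrict x (N - {n}) = y}. (\<Prod>k\<in>N. pmf (p k) (x k)) * g (x n))"
    unfolding E_def slice_def
    using finite_PiE_NX[of N] by (intro sum.mono_neutral_cong_right) auto
  also have "\<dots> = (\<Sum>a\<in>X n. (\<Prod>k\<in>N. pmf (p k) ((y(n := a)) k)) * g a)"
    unfolding img by (simp add: sum.reindex[OF inj])
  also have "\<dots> = (\<Sum>a\<in>X n. (\<Prod>k\<in>N - {n}. pmf (p k) (y k)) * (pmf (p n) a * g a))"
  proof (intro sum.cong refl)
    fix a
    have "(\<Prod>k\<in>N. pmf (p k) ((y(n := a)) k)) = pmf (p n) a * (\<Prod>k\<in>N - {n}. pmf (p k) ((y(n := a)) k))"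
      using finite_N n by (simp add: prod.remove[of N n])
    also have "(\<Prod>k\<in>N - {n}. pmf (p k) ((y(n := a)) k)) = (\<Prod>k\<in>N - {n}. pmf (p k) (y k))"
      by (intro prod.cong) auto
    finally show "(\<Prod>k\<in>N. pmf (p k) ((y(n := a)) k)) * g a
        = (\<Prod>k\<in>N - {n}. pmf (p k) (y k)) * (pmf (p n) a * g a)"
      by (simp only: mult_ac)
  qed
  finally show ?thesis by (simp add: sum_distrib_left)
qed

text \<open>The half-space \<open>E f \<ge> 0\<close> is a cone containing all generators, so both
  nested positive hulls stay inside it.\<close>

lemma E_nat_ext_nonneg:
  assumes "f \<in> nat_ext"
  shows "E f \<ge> 0"
proof -
  let ?C = "{f. E f \<ge> 0}"
  have cone: "pos_cone ?C"
    by (auto simp: pos_cone_def E_def distrib_left sum.distrib mult.left_commute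
        simp flip: sum_distrib_left)
  have "slice n y g \<in> ?C" if "n \<in> N" "g \<in> M n" "y \<in> Pi\<^sub>E (N - {n}) X" for n y g
    using rep[OF that(1)] that E_slice[OF that(1,3), of g]
    by (auto simp: represents_def intro!: mult_nonneg_nonneg prod_nonneg)
  then have "(\<Union>n\<in>N. posi {slice n y g | g y. g \<in> M n \<and> y \<in> Pi\<^sub>E (N - {n}) X}) \<subseteq> ?C"
    by (intro UN_least posi_least[OF cone]) auto
  moreover have "pos_gambles (Pi\<^sub>E N X) \<subseteq> ?C"
    by (auto simp: pos_gambles_iff E_def intro!: sum_nonneg mult_nonneg_nonneg prod_nonneg)
  ultimately have "nat_ext \<subseteq> ?C"
    unfolding nat_ext_eq by (intro posi_least[OF cone]) auto
  then show ?thesis using assms by auto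
qed

section \<open>Averaging out coordinates\<close>

text \<open>A version of the conditional expectation given all coordinates but \<open>n\<close>,
  under the product mass function.\<close>

definition average :: "'n \<Rightarrow> (('n \<Rightarrow> 'x) \<Rightarrow> real) \<Rightarrow> ('n \<Rightarrow> 'x) \<Rightarrow> real" where
  "average n f = (\<lambda>x. if x \<in> Pi\<^sub>E N X then \<Sum>a\<in>X n. pmf (p n) a * f (x(n := a)) else 0)"

text \<open>With the other coordinates fixed, \<open>s * (f - average n f)\<close> has expectation
  zero under \<open>p n\<close>, whatever the sign of \<open>s\<close>. Adding \<open>e\<close>
  makes it positive, so each section belongs to \<open>M n\<close>; the sections are then summed as
  slices.\<close>

lemma average_nat_ext:
  assumes n: "n \<in> N" and f: "f \<in> gambles (Pi\<^sub>E N X)" and e: "e > 0"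
  shows "(\<lambda>x. s * (f x - average n f x) + const_gamble (Pi\<^sub>E N X) e x) \<in> nat_ext"
proof -
  define g where "g y a = (if a \<in> X n then s * (f (y(n := a)) - (\<Sum>b\<in>X n. pmf (p n) b * f (y(n := b)))) + e else 0)"
    for y a
  have total: "(\<Sum>a\<in>X n. pmf (p n) a) = 1" using n X supp by (auto intro!: sum_pmf_eq_1)
  have "g y \<in> M n" for y
  proof -
    let ?c = "\<Sum>b\<in>X n. pmf (p n) b * f (y(n := b))"
    have "(\<Sum>a\<in>X n. pmf (p n) a * g y a)
      = (\<Sum>a\<in>X n. s * (pmf (p n) a * f (y(n := a))) + (e - s * ?c) * pmf (p n) a)"
      by (intro sum.cong refl) (simp add: g_def algebra_simps)
    also have "\<dots> = s * ?c + (e - s * ?c) * 1"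
      unfolding sum.distrib sum_distrib_left[symmetric] total ..
    finally have "(\<Sum>a\<in>X n. pmf (p n) a * g y a) > 0" using e by simp
    moreover have "g y \<in> gambles (X n)" by (auto simp: g_def gambles_def)
    ultimately show ?thesis using rep[OF n] by (auto simp: represents_def)
  qed
  then have "(\<lambda>x. \<Sum>y\<in>Pi\<^sub>E (N - {n}) X. slice n y (g y) x) \<in> nat_ext"
    using n by (intro pos_cone_sum[OF nat_ext_cone] finite_PiE_NX PiE_NX_ne slice_nat_ext) auto
  also have "(\<lambda>x. \<Sum>y\<in>Pi\<^sub>E (N - {n}) X. slice n y (g y) x)
    = (\<lambda>x. s * (f x - average n f x) + const_gamble (Pi\<^sub>E N X) e x)"
  proof
    fix x
    show "(\<Sum>y\<in>Pi\<^sub>E (N - {n}) X. slice n y (g y) x)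
      = s * (f x - average n f x) + const_gamble (Pi\<^sub>E N X) e x"
    proof (cases "x \<in> Pi\<^sub>E N X")
      case True
      let ?y = "restrict x (N - {n})"
      have upd: "?y(n := a) = x(n := a)" for a
        using True by (auto simp: fun_eq_iff PiE_def extensional_def restrict_def)
      have "(\<Sum>y\<in>Pi\<^sub>E (N - {n}) X. slice n y (g y) x) = (\<Sum>y\<in>{?y}. g y (x n))"
        using True finite_PiE_NX[of "N - {n}"]
        by (intro sum.mono_neutral_cong_right) (auto simp: slice_def)
      also have "\<dots> = s * (f x - average n f x) + const_gamble (Pi\<^sub>E N X) e x"
        using True n by (auto simp: g_def upd average_def const_gamble_def)
      finally show ?thesis .
    next
      case False
      then show ?thesis using f by (simp add: slice_def average_def const_gamble_def gambles_def)
    qed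
  qed
  finally show ?thesis .
qed

text \<open>
  Both signs are needed: since expectations are nonnegative on \<open>nat_ext\<close>, they show that the
  constant left for \<open>A = N\<close> is within \<open>e\<close> of \<open>E f\<close>, so no iterated-sum computation is required.
\<close>
lemma average_out:
  assumes "A \<subseteq> N" and f: "f \<in> gambles (Pi\<^sub>E N X)" and e: "e > 0"
  shows "\<exists>h\<in>gambles (Pi\<^sub>E N X).
    (\<forall>x\<in>Pi\<^sub>E N X. \<forall>y\<in>Pi\<^sub>E N X. (\<forall>n\<in>N - A. x n = y n) \<longrightarrow> h x = h y) \<and>
    (\<forall>s\<in>{1, -1}. (\<lambda>x. s * (f x - h x) + const_gamble (Pi\<^sub>E N X) e x) \<in> nat_ext)"
  using finite_subset[OF assms(1) finite_N] assms(1) e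
proof (induction A arbitrary: e rule: finite_induct)
  case empty
  have "x = y" if "x \<in> Pi\<^sub>E N X" "y \<in> Pi\<^sub>E N X" "\<forall>n\<in>N. x n = y n" for x y
    using that by (auto intro: PiE_ext)
  moreover have "const_gamble (Pi\<^sub>E N X) e \<in> nat_ext"
    using empty by (intro pos_nat_ext const_gamble_pos PiE_NX_ne) auto
  ultimately show ?case
    using f by (intro bexI[of _ f]) auto
next
  case (insert n A)
  then have n: "n \<in> N" and "e / 2 > 0" by auto
  have "A \<subseteq> N" using insert.prems by simp
  \<comment> \<open>Half of the tolerance goes to the coordinates in \<open>A\<close>, half to
    averaging over \<open>n\<close>.\<close>
  from insert.IH[OF this \<open>e / 2 > 0\<close>] obtain h where h: "h \<in> gambles (Pi\<^sub>E N X)"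
    and dep: "\<forall>x\<in>Pi\<^sub>E N X. \<forall>y\<in>Pi\<^sub>E N X. (\<forall>n\<in>N - A. x n = y n) \<longrightarrow> h x = h y"
    and hs: "\<forall>s\<in>{1, -1}. (\<lambda>x. s * (f x - h x) + const_gamble (Pi\<^sub>E N X) (e / 2) x) \<in> nat_ext"
    by (elim bexE conjE) (rule that)
  show ?case
  proof (intro bexI[of _ "average n h"] conjI ballI impI)
    show "average n h \<in> gambles (Pi\<^sub>E N X)" by (simp add: gambles_def average_def)
  next
    fix x y assume xy: "x \<in> Pi\<^sub>E N X" "y \<in> Pi\<^sub>E N X" "\<forall>k\<in>N - insert n A. x k = y k"
    \<comment> \<open>Once coordinate \<open>n\<close> is overwritten by the same \<open>a\<close>,
      the two points agree off \<open>A\<close>.\<close>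
    have "h (x(n := a)) = h (y(n := a))" if "a \<in> X n" for a
      using xy n that by (intro dep[rule_format]) (auto simp: PiE_iff extensional_def)
    then show "average n h x = average n h y" using xy by (simp add: average_def)
  next
    fix s :: real assume "s \<in> {1, -1}"
    note pos_cone_add[OF nat_ext_cone bspec[OF hs this] average_nat_ext[OF n h \<open>e / 2 > 0\<close>, of s]]
    moreover have "s * (f x - h x) + const_gamble (Pi\<^sub>E N X) (e / 2) x
        + (s * (h x - average n h x) + const_gamble (Pi\<^sub>E N X) (e / 2) x)
      = s * (f x - average n h x) + const_gamble (Pi\<^sub>E N X) e x" for x
      by (simp add: const_gamble_def right_diff_distrib)
    ultimately show "(\<lambda>x. s * (f x - average n h x) + const_gamble (Pi\<^sub>E N X) e x) \<in> nat_ext"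
      by (simp only:)
  qed
qed

lemma E_diff_const: "E (f - const_gamble (Pi\<^sub>E N X) c) = E f - c"
  using E_const[of c] by (simp add: E_def right_diff_distrib sum_subtractf)

lemma less_E_imp_nat_ext:
  assumes f: "f \<in> gambles (Pi\<^sub>E N X)" and less: "\<mu> < E f"
  shows "f - const_gamble (Pi\<^sub>E N X) \<mu> \<in> nat_ext"
proof -
  let ?Z = "Pi\<^sub>E N X"
  \<comment> \<open>One \<open>e\<close> is lost in \<open>E f \<le> c + e\<close>, another in the
    slack of \<open>hs\<close>; with a third of the gap, \<open>c - e - \<mu>\<close> is still at
    least \<open>e\<close>.\<close>
  define e where "e = (E f - \<mu>) / 3"
  have e: "e > 0" using less by (simp add: e_def)
  from average_out[OF subset_refl f e] obtain h where h: "h \<in> gambles ?Z"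
    and dep: "\<forall>x\<in>?Z. \<forall>y\<in>?Z. (\<forall>n\<in>N - N. x n = y n) \<longrightarrow> h x = h y"
    and hs: "\<forall>s\<in>{1, -1}. (\<lambda>x. s * (f x - h x) + const_gamble ?Z e x) \<in> nat_ext"
    by (elim bexE conjE) (rule that)
  obtain x0 where x0: "x0 \<in> ?Z" using PiE_NX_ne[OF subset_refl] by (metis ex_in_conv)
  define c where "c = h x0"
  \<comment> \<open>\<open>N - N\<close> is empty, so \<open>dep\<close> relates any two
    points.\<close>
  have hc: "h = const_gamble ?Z c"
  proof
    fix x
    show "h x = const_gamble ?Z c x"
      using h bspec[OF bspec[OF dep x0], of x] by (simp add: const_gamble_def c_def gambles_def)
  qed
  \<comment> \<open>The sign \<open>-1\<close> serves to compare \<open>c\<close> with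
    \<open>E f\<close>, through nonnegativity of \<open>E\<close> on \<open>nat_ext\<close>.\<close>
  have "(\<lambda>x. - 1 * (f x - h x) + const_gamble ?Z e x)
      = (\<lambda>x. - 1 * (f - const_gamble ?Z (c + e)) x)"
    by (auto simp: hc const_gamble_def fun_eq_iff)
  with bspec[OF hs, of "- 1"] have "0 \<le> E (\<lambda>x. - 1 * (f - const_gamble ?Z (c + e)) x)"
    using E_nat_ext_nonneg by simp
  also have "\<dots> = - 1 * E (f - const_gamble ?Z (c + e))"
    unfolding E_def sum_distrib_left by (intro sum.cong refl) (simp only: mult_ac)
  finally have "E f \<le> c + e" by (simp add: E_diff_const)
  then have "c - e - \<mu> > 0" using e by (simp add: e_def field_simps)
  then have "const_gamble ?Z (c - e - \<mu>) \<in> nat_ext"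
    by (intro pos_nat_ext const_gamble_pos PiE_NX_ne) auto
  \<comment> \<open>The sign \<open>1\<close> gives the membership: this gamble and the positive
    constant add up to \<open>f - \<mu>\<close>.\<close>
  from pos_cone_add[OF nat_ext_cone this bspec[OF hs, of 1]]
  have "(\<lambda>x. const_gamble ?Z (c - e - \<mu>) x + (1 * (f x - h x) + const_gamble ?Z e x)) \<in> nat_ext" by simp
  then show ?thesis
    by (rule back_subst[of "\<lambda>h. h \<in> nat_ext"]) (auto simp: hc const_gamble_def fun_eq_iff)
qed

lemma nat_ext_imp_le_E:
  assumes "f - const_gamble (Pi\<^sub>E N X) \<mu> \<in> nat_ext"
  shows "\<mu> \<le> E f"
  using E_nat_ext_nonneg[OF assms] by (simp add: E_diff_const)

lemma product_prevision_eq_E: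
  assumes "\<And>n. n \<in> N \<Longrightarrow> P n = measure_pmf.expectation (p n)"
  shows "product_prevision N P f = E f"
proof -
  have "product_prevision N P f = product_prevision N (\<lambda>n. measure_pmf.expectation (p n)) f"
    unfolding product_prevision_def using assms by (simp cong: Pi_pmf_cong)
  also have "\<dots> = E f"
    unfolding E_def using finite_N X supp by (intro product_prevision_eq_sum) auto
  finally show ?thesis .
qed

end

section \<open>Comparison of the two strong products\<close>

theorem theorem28:
  fixes N :: "'n set" and X :: "'n \<Rightarrow> 'x set" and D :: "'n \<Rightarrow> ('x \<Rightarrow> real) set"
  assumes "finite N" and "N \<noteq> {}"
    and "\<forall>n\<in>N. finite (X n) \<and> X n \<noteq> {}"
    and "\<forall>n\<in>N. coherent (X n) (D n)"
  shows "\<forall>f\<in>gambles (Pi\<^sub>E N X).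
           strong_product_prevision N X (\<lambda>n. lower_prevision (X n) (D n)) f
             = Sup {\<mu>. f - const_gamble (Pi\<^sub>E N X) \<mu> \<in> strong_product N X D}"
proof
  fix f assume f: "f \<in> gambles (Pi\<^sub>E N X)"
  let ?Z = "Pi\<^sub>E N X"
  define S where "S = {product_prevision N P f | P. \<forall>n\<in>N. P n \<in> credal_set (X n) (lower_prevision (X n) (D n))}"
  define A where "A = {\<mu>. f - const_gamble ?Z \<mu> \<in> strong_product N X D}"
  have locale_I: "represented_factors N X M p"
    if "\<forall>n\<in>N. M n \<in> maximal_supersets (X n) (D n)" "\<forall>n\<in>N. represents (X n) (M n) (p n)" for M p
    using assms that
    by unfold_locales (auto simp: maximal_supersets_def maximal_coherent_def coherent_iff)
  have rep_ex: "\<exists>p. \<forall>n\<in>N. represents (X n) (M n) (p n)"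
    if "\<forall>n\<in>N. M n \<in> maximal_supersets (X n) (D n)" for M
  proof -
    have "\<forall>n\<in>N. \<exists>p. represents (X n) (M n) p"
      using that assms(3) maximal_represented unfolding maximal_supersets_def
      by (metis (no_types, lifting) mem_Collect_eq)
    then show ?thesis by (rule bchoice)
  qed
  have credal: "\<forall>n\<in>N. measure_pmf.expectation (p n) \<in> credal_set (X n) (lower_prevision (X n) (D n))"
    if "\<forall>n\<in>N. M n \<in> maximal_supersets (X n) (D n)" "\<forall>n\<in>N. represents (X n) (M n) (p n)" for M p
  proof
    fix n assume "n \<in> N"
    with that assms show "measure_pmf.expectation (p n) \<in> credal_set (X n) (lower_prevision (X n) (D n))"
      by (intro represents_imp_credal[of _ _ "M n"]) (auto simp: maximal_supersets_def)
  qed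
  have A_le_S: "\<mu> \<le> s" if \<mu>: "\<mu> \<in> A" and sS: "s \<in> S" for \<mu> s
  proof -
    obtain P where s: "s = product_prevision N P f"
      and P: "\<forall>n\<in>N. P n \<in> credal_set (X n) (lower_prevision (X n) (D n))"
      using sS unfolding S_def by blast
    \<comment> \<open>Pairs let a single choice over \<open>N\<close> provide mass functions and
      maximal sets together.\<close>
    have "\<forall>n\<in>N. \<exists>pM. P n = measure_pmf.expectation (fst pM) \<and>
        snd pM \<in> maximal_supersets (X n) (D n) \<and> represents (X n) (snd pM) (fst pM)"
    proof
      fix n assume "n \<in> N"
      then obtain p M where "P n = measure_pmf.expectation p" "M \<in> maximal_supersets (X n) (D n)"
        "represents (X n) M p"
        using credal_imp_represents[of "X n" "D n" "P n"] assms P by metis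
      then show "\<exists>pM. P n = measure_pmf.expectation (fst pM) \<and>
        snd pM \<in> maximal_supersets (X n) (D n) \<and> represents (X n) (snd pM) (fst pM)"
        by (intro exI[of _ "(p, M)"]) simp
    qed
    from bchoice[OF this] obtain q where q: "\<forall>n\<in>N. P n = measure_pmf.expectation (fst (q n)) \<and>
        snd (q n) \<in> maximal_supersets (X n) (D n) \<and> represents (X n) (snd (q n)) (fst (q n))"
      by blast
    interpret represented_factors N X "\<lambda>n. snd (q n)" "\<lambda>n. fst (q n)"
      using q by (intro locale_I) auto
    \<comment> \<open>Membership in the strong product holds for every choice of maximal sets, in
      particular for the one representing \<open>P\<close>.\<close>
    have "f - const_gamble ?Z \<mu> \<in> nat_ext"
      using \<mu> q unfolding A_def strong_product_def nat_ext_def by blast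
    then have "\<mu> \<le> E f" by (rule nat_ext_imp_le_E)
    then show ?thesis using product_prevision_eq_E[of P f] q s by simp
  qed
  \<comment> \<open>\<open>Inf\<close> and \<open>Sup\<close> on the reals are controlled only for
    nonempty bounded sets; this is now secured for \<open>S\<close> and \<open>A\<close>, the bounds
    coming from \<open>A_le_S\<close>.\<close>
  have "\<forall>n\<in>N. \<exists>M. M \<in> maximal_supersets (X n) (D n)"
    using assms(4) coherent_extends_to_maximal by metis
  from bchoice[OF this] obtain M0 where M0: "\<forall>n\<in>N. M0 n \<in> maximal_supersets (X n) (D n)" by blast
  with rep_ex obtain p0 where "\<forall>n\<in>N. represents (X n) (M0 n) (p0 n)" by blast
  with credal[OF M0] have S_ne: "S \<noteq> {}" unfolding S_def by fastforce
  have "finite ?Z" "?Z \<noteq> {}"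
    using assms by (auto intro: finite_PiE simp: PiE_eq_empty_iff)
  then obtain \<mu>0 where \<mu>0: "f - const_gamble ?Z \<mu>0 \<in> pos_gambles ?Z"
    using pos_minus_const f by blast
  have "\<mu>0 \<in> A"
    using \<mu>0 posi_superset unfolding A_def strong_product_def independent_nat_ext_def by blast
  have S_bdd: "bdd_below S"
    using A_le_S[OF \<open>\<mu>0 \<in> A\<close>] by (rule bdd_belowI)
  have less_A: "\<mu> \<in> A" if "\<mu> < Inf S" for \<mu>
  proof -
    \<comment> \<open>Each choice \<open>M\<close> has representing mass functions whose product
      prevision is in \<open>S\<close>, so one \<open>\<mu>\<close> below the infimum works for all
      choices at once.\<close>
    have "f - const_gamble ?Z \<mu> \<in> independent_nat_ext N X M"
      if M: "\<forall>n\<in>N. M n \<in> maximal_supersets (X n) (D n)" for M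
    proof -
      obtain p where p: "\<forall>n\<in>N. represents (X n) (M n) (p n)" using rep_ex[OF M] by blast
      interpret represented_factors N X M p by (rule locale_I[OF M p])
      have "product_prevision N (\<lambda>n. measure_pmf.expectation (p n)) f \<in> S"
        using credal[OF M p] unfolding S_def by blast
      then have "E f \<in> S" by (simp add: product_prevision_eq_E)
      then have "\<mu> < E f" using \<open>\<mu> < Inf S\<close> cInf_lower[OF _ S_bdd] by fastforce
      then show ?thesis using less_E_imp_nat_ext[OF f] by (simp add: nat_ext_def)
    qed
    then show ?thesis unfolding A_def strong_product_def by blast
  qed
  obtain s0 where "s0 \<in> S" using S_ne by blast
  then have A_bdd: "bdd_above A"
    using A_le_S unfolding bdd_above_def by blast
  have "Inf S = Sup A"
  proof (rule antisym)
    show "Inf S \<le> Sup A"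
      \<comment> \<open>Only prices strictly below \<open>Inf S\<close> are known to lie in
        \<open>A\<close>, hence the density argument.\<close>
      by (rule dense_le) (rule cSup_upper[OF less_A A_bdd])
    show "Sup A \<le> Inf S"
    proof (rule cSup_least)
      show "A \<noteq> {}" using \<open>\<mu>0 \<in> A\<close> by blast
      show "\<mu> \<le> Inf S" if "\<mu> \<in> A" for \<mu>
        using S_ne A_le_S[OF that] by (rule cInf_greatest)
    qed
  qed
  then show "strong_product_prevision N X (\<lambda>n. lower_prevision (X n) (D n)) f
      = Sup {\<mu>. f - const_gamble ?Z \<mu> \<in> strong_product N X D}"
    unfolding strong_product_prevision_def S_def A_def .
qed

end
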